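(* Let $n\ge4$, $r\ge1$. For a finite forest $F$ (no isolated vertices) with at most $n$ vertices and a function $\alpha:E(F)\to\mathbb Z_{>0}$ with $|\alpha|=\sum_e\alpha_e=r$, choose an injective labelling of $V(F)$ by elements of $[n]$ and let $C_{F,\alpha}(n)$ be the sum of $\chi^{(n-2,2)}(\tau_{e_1}\cdots\tau_{e_r})$ over all words $(e_1,\dots,e_r)$ in the edges of $F$ in which each edge $e$ occurs exactly $\alpha_e$ times. Then $C_{F,\alpha}(n)$ is independent of the chosen labelling (and depends only on the isomorphism class of $(F,\alpha)$), and for every tree $T$ on $[n]$, $$\mathcal M_r^{(2)}(T;y)=\sum_{\substack{(F,\alpha)\\|\alpha|=r}}C_{F,\alpha}(n)\sum_{(S,\beta)\cong(F,\alpha)}\ \prod_{e\in S}y_e^{\beta_e},$$ where the outer sum runs over isomorphism classes of forests with positive edge multiplicities and total multiplicity $r$, and the inner sum runs over all embedded copies of $(F,\alpha)$ in $T$, i.e. pairs consisting of a nonempty subset $S\subseteq E(T)$ and a function $\beta:S\to\mathbb Z_{>0}$ such that the edge-induced forest on $S$ with multiplicities $\beta$ is isomorphic to $(F,\alpha)$.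
   Context: For an edge $e=ij$, $\tau_e=(ij)\in S_n$; $\chi^{(n-2,2)}$ is the irreducible character of $S_n$ indexed by the partition $(n-2,2)$. For a tree $T$ on $[n]$, introduce independent variables $y_e$, $e\in E(T)$, and set $X_T(y)=\sum_{e\in E(T)}y_e\tau_e\in\mathbb C[y_e:e\in E(T)][S_n]$. The weighted trace polynomial is $\mathcal M_r^{(2)}(T;y)=\operatorname{tr}_{(n-2,2)}(X_T(y)^r)$, the trace of $X_T(y)^r$ acting (with coefficients extended to the polynomial ring) on the irreducible representation $(n-2,2)$. *)

theory Defs
  imports
    Complex_Main
    "HOL-Library.Poly_Mapping"
    "HOL-Library.Function_Algebras"
    "HOL-Library.FuncSet"
    "HOL-Combinatorics.Permutations"
begin

section \<open>Function modules and traces\<close>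

definition pscale :: "'r::comm_ring_1 \<Rightarrow> ('t \<Rightarrow> 'r) \<Rightarrow> ('t \<Rightarrow> 'r)" where
  "pscale c v = (\<lambda>t. c * v t)"

global_interpretation fmod: module "pscale :: 'r::comm_ring_1 \<Rightarrow> ('t \<Rightarrow> 'r) \<Rightarrow> ('t \<Rightarrow> 'r)"
  by unfold_locales (auto simp: pscale_def fun_eq_iff algebra_simps)

text \<open>Trace of an endomorphism \<open>f\<close> of a submodule \<open>V\<close> that is free of finite rank: the sum of the
  diagonal entries of the matrix of \<open>f\<close> in a basis of \<open>V\<close>. Over a commutative ring the value does
  not depend on the basis.\<close>

definition is_basis :: "('t \<Rightarrow> 'r::comm_ring_1) set \<Rightarrow> ('t \<Rightarrow> 'r) set \<Rightarrow> bool" where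
  "is_basis V B \<longleftrightarrow> finite B \<and> fmod.independent B \<and> fmod.span B = V"

definition trace_on :: "('t \<Rightarrow> 'r::comm_ring_1) set \<Rightarrow> (('t \<Rightarrow> 'r) \<Rightarrow> ('t \<Rightarrow> 'r)) \<Rightarrow> 'r" where
  "trace_on V f = (let B = (SOME B. is_basis V B) in \<Sum>b\<in>B. fmod.representation B (f b) b)"

section \<open>Specht modules\<close>

text \<open>A partition \<open>\<lambda>\<close> is the list of its parts. A tabloid is the list of the row sets of a tableau.
  The permutation module on tabloids consists of the functions on tabloids, and the Specht module is
  its subspace spanned by the polytabloids \<open>e\<^sub>t = \<Sum>\<pi>\<in>C\<^sub>t. sign \<pi> \<cdot> {\<pi> t}\<close>, where \<open>C\<^sub>t\<close> is the
  column stabilizer of \<open>t\<close>. In characteristic 0 it is the irreducible module indexed by \<open>\<lambda>\<close>.\<close>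

type_synonym tabloid = "nat set list"

definition diagram :: "nat list \<Rightarrow> (nat \<times> nat) set" where
  "diagram lam = {(i, j). i < length lam \<and> j < lam ! i}"

definition is_tableau :: "nat list \<Rightarrow> (nat \<times> nat \<Rightarrow> nat) \<Rightarrow> bool" where
  "is_tableau lam t \<longleftrightarrow> bij_betw t (diagram lam) {1..sum_list lam}"

definition tabloid_of :: "nat list \<Rightarrow> (nat \<times> nat \<Rightarrow> nat) \<Rightarrow> tabloid" where
  "tabloid_of lam t = map (\<lambda>i. {t (i, j) |j. (i, j) \<in> diagram lam}) [0..<length lam]"

definition column_stabilizer :: "nat list \<Rightarrow> (nat \<times> nat \<Rightarrow> nat) \<Rightarrow> (nat \<Rightarrow> nat) set" where
  "column_stabilizer lam t =
     {\<pi>. \<pi> permutes {1..sum_list lam} \<and>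
         (\<forall>j. \<pi> ` {t (i, j) |i. (i, j) \<in> diagram lam} = {t (i, j) |i. (i, j) \<in> diagram lam})}"

definition polytabloid :: "nat list \<Rightarrow> (nat \<times> nat \<Rightarrow> nat) \<Rightarrow> tabloid \<Rightarrow> complex" where
  "polytabloid lam t =
     (\<lambda>T. \<Sum>\<pi>\<in>column_stabilizer lam t. if T = tabloid_of lam (\<pi> \<circ> t) then of_int (sign \<pi>) else 0)"

definition specht :: "nat list \<Rightarrow> (tabloid \<Rightarrow> complex) set" where
  "specht lam = fmod.span {polytabloid lam t |t. is_tableau lam t}"

definition perm_act :: "(nat \<Rightarrow> nat) \<Rightarrow> (tabloid \<Rightarrow> 'r) \<Rightarrow> (tabloid \<Rightarrow> 'r)" where
  "perm_act \<sigma> v = (\<lambda>T. v (map (image (inv \<sigma>)) T))"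

definition irr_char :: "nat list \<Rightarrow> (nat \<Rightarrow> nat) \<Rightarrow> complex" where
  "irr_char lam \<sigma> = trace_on (specht lam) (perm_act \<sigma>)"

section \<open>Polynomials and the group algebra\<close>

text \<open>Polynomials with complex coefficients in variables indexed by \<open>'x\<close>.\<close>

type_synonym 'x cpoly = "('x \<Rightarrow>\<^sub>0 nat) \<Rightarrow>\<^sub>0 complex"

definition pconst :: "complex \<Rightarrow> 'x cpoly" where
  "pconst c = Poly_Mapping.single 0 c"

definition pvar :: "'x \<Rightarrow> 'x cpoly" where
  "pvar x = Poly_Mapping.single (Poly_Mapping.single x 1) 1"

text \<open>Extension of scalars of a subspace \<open>V\<close> to the polynomial ring, realised as the image of the
  tensor product inside the polynomial-valued functions.\<close>

definition extend_scalars :: "('t \<Rightarrow> complex) set \<Rightarrow> ('t \<Rightarrow> 'x cpoly) set" where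
  "extend_scalars V = fmod.span ((\<lambda>v t. pconst (v t)) ` V)"

text \<open>Elements of the group algebra of \<open>S\<^sub>n\<close> over \<open>'r\<close> are functions
  vanishing off the permutations of \<open>{1..n}\<close>.\<close>

definition ga_mult :: "nat \<Rightarrow> ((nat \<Rightarrow> nat) \<Rightarrow> 'r::comm_ring_1) \<Rightarrow> ((nat \<Rightarrow> nat) \<Rightarrow> 'r)
    \<Rightarrow> ((nat \<Rightarrow> nat) \<Rightarrow> 'r)" where
  "ga_mult n a b = (\<lambda>g. if g permutes {1..n}
     then \<Sum>h | h permutes {1..n}. a h * b (inv h \<circ> g) else 0)"

definition ga_one :: "(nat \<Rightarrow> nat) \<Rightarrow> 'r::comm_ring_1" where
  "ga_one = (\<lambda>g. if g = id then 1 else 0)"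

primrec ga_power :: "nat \<Rightarrow> ((nat \<Rightarrow> nat) \<Rightarrow> 'r::comm_ring_1) \<Rightarrow> nat \<Rightarrow> ((nat \<Rightarrow> nat) \<Rightarrow> 'r)" where
  "ga_power n a 0 = ga_one"
| "ga_power n a (Suc r) = ga_mult n a (ga_power n a r)"

definition ga_act :: "nat \<Rightarrow> ((nat \<Rightarrow> nat) \<Rightarrow> 'r::comm_ring_1) \<Rightarrow> (tabloid \<Rightarrow> 'r)
    \<Rightarrow> (tabloid \<Rightarrow> 'r)" where
  "ga_act n a v = (\<Sum>g | g permutes {1..n}. pscale (a g) (perm_act g v))"

section \<open>Trees and forests\<close>

text \<open>Edges are two-element sets of vertices. A forest without isolated vertices is given by its
  edge set \<open>E\<close>, its vertex set being \<open>\<Union>E\<close>.\<close>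

definition is_cycle :: "'v set set \<Rightarrow> 'v list \<Rightarrow> bool" where
  "is_cycle E c \<longleftrightarrow> 3 \<le> length c \<and> distinct c \<and>
     (\<forall>i<length c. {c ! i, c ! (Suc i mod length c)} \<in> E)"

definition is_forest :: "'v set set \<Rightarrow> bool" where
  "is_forest E \<longleftrightarrow> finite E \<and> (\<forall>e\<in>E. card e = 2) \<and> (\<nexists>c. is_cycle E c)"

definition is_tree_on :: "'v set \<Rightarrow> 'v set set \<Rightarrow> bool" where
  "is_tree_on V E \<longleftrightarrow> is_forest E \<and> \<Union>E \<subseteq> V \<and> (\<forall>u\<in>V. \<forall>v\<in>V. (u, v) \<in> {(a, b). {a, b} \<in> E}\<^sup>*)"

definition edge_transp :: "'v set \<Rightarrow> 'v \<Rightarrow> 'v" where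
  "edge_transp e = (THE \<tau>. \<exists>i j. e = {i, j} \<and> \<tau> = Transposition.transpose i j)"

definition X_elem :: "nat set set \<Rightarrow> (nat \<Rightarrow> nat) \<Rightarrow> nat set cpoly" where
  "X_elem E = (\<lambda>g. \<Sum>e\<in>E. if g = edge_transp e then pvar e else 0)"

definition weighted_trace_poly :: "nat \<Rightarrow> nat \<Rightarrow> nat set set \<Rightarrow> nat set cpoly" where
  "weighted_trace_poly n r E =
     trace_on (extend_scalars (specht [n - 2, 2])) (ga_act n (ga_power n (X_elem E) r))"

section \<open>Forests with edge multiplicities\<close>

type_synonym 'v wforest = "'v set set \<times> ('v set \<Rightarrow> nat)"

text \<open>\<open>wforests n r\<close>: forests with at most \<open>n\<close> vertices and positive multiplicities of total \<open>r\<close>.\<close>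

definition wforests :: "nat \<Rightarrow> nat \<Rightarrow> 'v wforest set" where
  "wforests n r = {(F, \<alpha>). is_forest F \<and> card (\<Union>F) \<le> n \<and> \<alpha> \<in> F \<rightarrow>\<^sub>E {0<..} \<and> (\<Sum>e\<in>F. \<alpha> e) = r}"

definition wf_iso :: "'v wforest \<Rightarrow> 'w wforest \<Rightarrow> bool" where
  "wf_iso = (\<lambda>(F, \<alpha>) (G, \<beta>). \<exists>f. bij_betw f (\<Union>F) (\<Union>G) \<and> (image f) ` F = G \<and>
     (\<forall>e\<in>F. \<beta> (f ` e) = \<alpha> e))"

definition labelling :: "nat \<Rightarrow> 'v wforest \<Rightarrow> ('v \<Rightarrow> nat) \<Rightarrow> bool" where
  "labelling n = (\<lambda>(F, \<alpha>) \<phi>. inj_on \<phi> (\<Union>F) \<and> \<phi> ` \<Union>F \<subseteq> {1..n})"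

definition mult_words :: "'v wforest \<Rightarrow> 'v set list set" where
  "mult_words = (\<lambda>(F, \<alpha>). {w. set w \<subseteq> F \<and> (\<forall>e\<in>F. count_list w e = \<alpha> e)})"

definition coeff_lab :: "nat \<Rightarrow> 'v wforest \<Rightarrow> ('v \<Rightarrow> nat) \<Rightarrow> complex" where
  "coeff_lab n P \<phi> = (\<Sum>w\<in>mult_words P.
     irr_char [n - 2, 2] (foldr (\<lambda>e p. edge_transp (\<phi> ` e) \<circ> p) w id))"

definition forest_coeff :: "nat \<Rightarrow> 'v wforest \<Rightarrow> complex" where
  "forest_coeff n P = coeff_lab n P (SOME \<phi>. labelling n P \<phi>)"

text \<open>Every finite forest is isomorphic to one with vertices in \<open>nat\<close>, so the isomorphism classes
  can be taken there.\<close>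

definition wforest_classes :: "nat \<Rightarrow> nat \<Rightarrow> nat wforest set set" where
  "wforest_classes n r =
     wforests n r // {(P, Q). P \<in> wforests n r \<and> Q \<in> wforests n r \<and> wf_iso P Q}"

definition class_rep :: "'v wforest set \<Rightarrow> 'v wforest" where
  "class_rep K = (SOME P. P \<in> K)"

definition copies :: "'v set set \<Rightarrow> 'w wforest \<Rightarrow> 'v wforest set" where
  "copies E P = {(S, \<beta>). S \<noteq> {} \<and> S \<subseteq> E \<and> \<beta> \<in> S \<rightarrow>\<^sub>E {0<..} \<and> wf_iso (S, \<beta>) P}"

end

(* Conjugating a word in transpositions by a permutation of {1..n} relabels it, and characters are
   class functions, so the coefficient of (F, alpha) depends on neither the labelling nor the
   representative of the isomorphism class. A basis B of the Specht module is also a basis of its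
   extension of scalars, so the weighted trace is linear in the group algebra element and expands
   as a sum of monomials times character values over the words of length r in the edges of the tree.
   The words with a given edge multiplicity function beta on their support S contribute the monomial
   of beta times the coefficient of (S, beta); collecting the (S, beta) by isomorphism class gives
   the formula. *)
theory Submission
  imports Defs
begin

section \<open>Traces over commutative rings\<close>

text \<open>Expand \<open>x\<close> in \<open>C\<close>, apply \<open>f\<close>, and read off the
  \<open>b\<close>-coordinate: this is multiplication by the matrix of \<open>f\<close> from source
  basis \<open>C\<close> to target basis \<open>B\<close>. Stability of \<open>V\<close> under
  \<open>f\<close> puts each \<open>f c\<close> in the span of \<open>B\<close>.\<close>

lemma representation_compose:
  assumes B: "is_basis V B" and C: "is_basis V C" and f: "module_hom pscale pscale f"
    and fV: "\<And>v. v \<in> V \<Longrightarrow> f v \<in> V" and x: "x \<in> V"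
  shows "fmod.representation B (f x) b =
    (\<Sum>c\<in>C. fmod.representation C x c * fmod.representation B (f c) b)"
proof -
  interpret f: module_hom pscale pscale f by (rule f)
  have *: "x = (\<Sum>c\<in>C. pscale (fmod.representation C x c) c)"
    using C x by (intro fmod.sum_representation_eq[symmetric]) (auto simp: is_basis_def)
  have CV: "c \<in> V" if "c \<in> C" for c
    using C that by (auto simp: is_basis_def intro: fmod.span_base)
  have fc: "f c \<in> fmod.span B" if "c \<in> C" for c
    using fV[OF CV[OF that]] B by (auto simp: is_basis_def)
  have fx: "f x = (\<Sum>c\<in>C. pscale (fmod.representation C x c) (f c))"
    by (subst *) (simp add: f.sum f.scale)
  show ?thesis
    unfolding fx using B fc by (subst fmod.representation_sum)
      (auto simp: is_basis_def fmod.span_scale fmod.representation_scale)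
qed

text \<open>Both sides are the same double sum of products of matrix entries of \<open>f\<close> and
  \<open>g\<close>, summed in opposite orders. Keeping two bases lets one lemma serve twice: with
  \<open>g\<close> the identity it gives independence of the basis, and with \<open>B = C\<close> it
  gives cyclicity of the trace.\<close>

lemma trace_compose_commute:
  assumes B: "is_basis V B" and C: "is_basis V C"
    and f: "module_hom pscale pscale f" "\<And>v. v \<in> V \<Longrightarrow> f v \<in> V"
    and g: "module_hom pscale pscale g" "\<And>v. v \<in> V \<Longrightarrow> g v \<in> V"
  shows "(\<Sum>b\<in>B. fmod.representation B (f (g b)) b) = (\<Sum>c\<in>C. fmod.representation C (g (f c)) c)"
proof -
  have BV: "b \<in> V" if "b \<in> B" for b
    using B that by (auto simp: is_basis_def intro: fmod.span_base)
  have CV: "c \<in> V" if "c \<in> C" for c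
    using C that by (auto simp: is_basis_def intro: fmod.span_base)
  have "(\<Sum>b\<in>B. fmod.representation B (f (g b)) b) =
      (\<Sum>b\<in>B. \<Sum>c\<in>C. fmod.representation C (g b) c * fmod.representation B (f c) b)"
    using g(2) BV by (intro sum.cong refl representation_compose[OF B C f]) auto
  also have "\<dots> = (\<Sum>c\<in>C. \<Sum>b\<in>B. fmod.representation B (f c) b * fmod.representation C (g b) c)"
    by (subst sum.swap) (simp add: mult.commute)
  also have "\<dots> = (\<Sum>c\<in>C. fmod.representation C (g (f c)) c)"
    using f(2) CV by (intro sum.cong refl representation_compose[OF C B g, symmetric]) auto
  finally show ?thesis .
qed

lemma module_hom_pscale_id: "module_hom pscale pscale (\<lambda>v. v)"
  by (intro module_hom.intro fmod.module_axioms module_hom_axioms.intro) auto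

lemma trace_on_eq:
  assumes B: "is_basis V B" and f: "module_hom pscale pscale f" "\<And>v. v \<in> V \<Longrightarrow> f v \<in> V"
  shows "trace_on V f = (\<Sum>b\<in>B. fmod.representation B (f b) b)"
proof -
  have "is_basis V (SOME B. is_basis V B)"
    using B by (rule someI)
  \<comment> \<open>Taking the identity as second map compares the trace in the chosen basis with
    the trace in \<open>B\<close>.\<close>
  from trace_compose_commute[OF this B f module_hom_pscale_id] show ?thesis
    by (simp add: trace_on_def Let_def)
qed

lemma trace_on_commute:
  assumes B: "is_basis V B"
    and f: "module_hom pscale pscale f" "\<And>v. v \<in> V \<Longrightarrow> f v \<in> V"
    and g: "module_hom pscale pscale g" "\<And>v. v \<in> V \<Longrightarrow> g v \<in> V"
  shows "trace_on V (\<lambda>v. f (g v)) = trace_on V (\<lambda>v. g (f v))"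
proof -
  have "module_hom pscale pscale (\<lambda>v. f (g v))" "module_hom pscale pscale (\<lambda>v. g (f v))"
    using module_hom_compose[OF f(1) g(1)] module_hom_compose[OF g(1) f(1)] by (simp_all add: o_def)
  then show ?thesis
    using trace_on_eq[OF B, of "\<lambda>v. f (g v)"] trace_on_eq[OF B, of "\<lambda>v. g (f v)"]
      trace_compose_commute[OF B B f g] f(2) g(2) by simp
qed

text \<open>The scalars are now a field, so a maximal independent subset of the generators spans,
  and it is finite because the generating set is.\<close>

lemma ex_is_basis_span:
  assumes "finite (S :: ('t \<Rightarrow> complex) set)"
  shows "\<exists>B. is_basis (fmod.span S) B"
proof -
  interpret vs: vector_space "pscale :: complex \<Rightarrow> ('t \<Rightarrow> complex) \<Rightarrow> _"
    by unfold_locales (auto simp: pscale_def fun_eq_iff algebra_simps)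
  obtain B where B: "B \<subseteq> S" "fmod.independent B" "S \<subseteq> fmod.span B"
    using vs.maximal_independent_subset by blast
  then have "fmod.span B = fmod.span S"
    by (meson antisym fmod.span_minimal fmod.subspace_span fmod.span_mono)
  with B assms show ?thesis
    by (auto simp: is_basis_def intro: finite_subset)
qed

section \<open>The action of permutations on Specht modules\<close>

lemma module_hom_perm_act: "module_hom pscale pscale (perm_act \<sigma>)"
  by (intro module_hom.intro fmod.module_axioms module_hom_axioms.intro)
    (auto simp: perm_act_def pscale_def fun_eq_iff)

lemma perm_act_compose:
  assumes "bij g" "bij h"
  shows "perm_act (g \<circ> h) v = perm_act g (perm_act h v)"
  using assms by (simp add: perm_act_def o_inv_distrib image_comp) (simp add: o_def image_image)

lemma map_image_inv_eq_iff:
  assumes "bij g"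
  shows "map (image (inv g)) T = U \<longleftrightarrow> T = map (image g) U"
  using assms
  by (auto simp: image_comp o_def bij_is_surj surj_f_inv_f bij_is_inj)

lemma tabloid_of_compose: "tabloid_of lam (g \<circ> t) = map (image g) (tabloid_of lam t)"
  by (auto simp: tabloid_of_def)

text \<open>The columns of \<open>g \<circ> t\<close> are the \<open>g\<close>-images of the columns
  of \<open>t\<close>, so passing from \<open>t\<close> to \<open>g \<circ> t\<close> conjugates the
  column stabilizer by \<open>g\<close>.\<close>

lemma mem_column_stabilizer_compose:
  assumes g: "g permutes {1..sum_list lam}"
  shows "\<pi> \<in> column_stabilizer lam t \<longleftrightarrow> g \<circ> \<pi> \<circ> inv g \<in> column_stabilizer lam (g \<circ> t)"
proof -
  let ?A = "\<lambda>t j. {t (i, j) |i. (i, j) \<in> diagram lam}"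
  have 1: "?A (g \<circ> t) j = g ` ?A t j" for j by auto
  have ig: "inv g (g x) = x" "g (inv g x) = x" for x
    using permutes_inverses[OF g] by auto
  have 2: "(g \<circ> \<pi> \<circ> inv g) ` ?A (g \<circ> t) j = g ` \<pi> ` ?A t j" for j
    unfolding 1 image_comp by (simp add: o_def ig)
  have 3: "g ` X = g ` Y \<longleftrightarrow> X = Y" for X Y
    using permutes_inj[OF g] by (rule inj_image_eq_iff)
  have "\<pi> = inv g \<circ> (g \<circ> \<pi> \<circ> inv g) \<circ> g"
    by (simp add: fun_eq_iff ig)
  then have 4: "\<pi> permutes {1..sum_list lam} \<longleftrightarrow> g \<circ> \<pi> \<circ> inv g permutes {1..sum_list lam}"
    using permutes_compose permutes_inv g by metis
  show ?thesis
    unfolding column_stabilizer_def mem_Collect_eq 2 4 unfolding 1 3 ..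
qed

lemma sign_conjugate:
  assumes "permutation g" "permutation p"
  shows "sign (g \<circ> p \<circ> inv g) = sign p"
proof -
  have "sign g * sign p * sign g = sign p"
    by (simp add: sign_def)
  with assms show ?thesis
    by (simp add: sign_compose sign_inverse permutation_compose permutation_inverse)
qed

text \<open>Conjugation by \<open>g\<close> reindexes the sum over the column stabilizer: it
  preserves signs, and the conjugate of \<open>\<pi>\<close> sends \<open>g \<circ> t\<close> to
  \<open>g \<circ> \<pi> \<circ> t\<close>.\<close>

lemma perm_act_polytabloid:
  assumes g: "g permutes {1..sum_list lam}"
  shows "perm_act g (polytabloid lam t) = polytabloid lam (g \<circ> t)"
proof
  fix T
  have bg: "bij g" using g by (rule permutes_bij)
  have ig: "inv g (g x) = x" "g (inv g x) = x" for x
    using permutes_inverses[OF g] by auto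
  have "perm_act g (polytabloid lam t) T = (\<Sum>\<pi>\<in>column_stabilizer lam t.
      if T = tabloid_of lam (g \<circ> (\<pi> \<circ> t)) then of_int (sign \<pi>) else 0)"
    by (simp only: perm_act_def polytabloid_def map_image_inv_eq_iff[OF bg] tabloid_of_compose[of lam g])
  also have "\<dots> = (\<Sum>\<pi>\<in>column_stabilizer lam (g \<circ> t).
      if T = tabloid_of lam (\<pi> \<circ> (g \<circ> t)) then of_int (sign \<pi>) else 0)"
  proof (rule sum.reindex_bij_witness[where i = "\<lambda>\<pi>. inv g \<circ> \<pi> \<circ> g" and j = "\<lambda>\<pi>. g \<circ> \<pi> \<circ> inv g"])
    fix \<pi> assume p: "\<pi> \<in> column_stabilizer lam t"
    have "permutation g" "permutation \<pi>"
      using p g by (auto simp: column_stabilizer_def permutation_permutes)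
    then show "(if T = tabloid_of lam (g \<circ> \<pi> \<circ> inv g \<circ> (g \<circ> t))
          then of_int (sign (g \<circ> \<pi> \<circ> inv g)) else 0) =
        (if T = tabloid_of lam (g \<circ> (\<pi> \<circ> t)) then of_int (sign \<pi>) else (0 :: complex))"
      by (simp add: sign_conjugate) (simp add: o_def ig)
    show "g \<circ> \<pi> \<circ> inv g \<in> column_stabilizer lam (g \<circ> t)"
      using p mem_column_stabilizer_compose[OF g] by blast
  next
    fix \<pi> assume p: "\<pi> \<in> column_stabilizer lam (g \<circ> t)"
    have "g \<circ> (inv g \<circ> \<pi> \<circ> g) \<circ> inv g = \<pi>" by (simp add: fun_eq_iff ig)
    then show "inv g \<circ> \<pi> \<circ> g \<in> column_stabilizer lam t"
      using p mem_column_stabilizer_compose[OF g, of "inv g \<circ> \<pi> \<circ> g" t] by simp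
  qed (simp_all add: fun_eq_iff ig)
  finally show "perm_act g (polytabloid lam t) T = polytabloid lam (g \<circ> t) T"
    by (simp add: polytabloid_def)
qed

lemma perm_act_specht:
  assumes g: "g permutes {1..sum_list lam}" and v: "v \<in> specht lam"
  shows "perm_act g v \<in> specht lam"
proof -
  interpret g: module_hom pscale pscale "perm_act g :: (tabloid \<Rightarrow> complex) \<Rightarrow> _"
    by (rule module_hom_perm_act)
  have "is_tableau lam (g \<circ> t)" if "is_tableau lam t" for t
    using that permutes_imp_bij[OF g] unfolding is_tableau_def by (rule bij_betw_trans)
  then have "perm_act g ` {polytabloid lam t |t. is_tableau lam t} \<subseteq> {polytabloid lam t |t. is_tableau lam t}"
    using perm_act_polytabloid[OF g] by blast
  from fmod.span_mono[OF this] v show ?thesis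
    unfolding specht_def g.span_image by blast
qed

lemma finite_diagram: "finite (diagram lam)"
proof (rule finite_subset)
  show "diagram lam \<subseteq> Sigma {..<length lam} (\<lambda>i. {..<lam ! i})"
    by (auto simp: diagram_def)
qed auto

text \<open>A tableau is a total function, so infinitely many tableaux share the same entries.
  Cutting down to the diagram leaves a finite set of functions that still yields every polytabloid;
  the finite basis of the Specht module comes from this.\<close>

lemma polytabloid_restrict:
  "polytabloid lam (restrict t (diagram lam)) = polytabloid lam t"
proof -
  have 1: "tabloid_of lam (\<pi> \<circ> restrict t (diagram lam)) = tabloid_of lam (\<pi> \<circ> t)" for \<pi>
    by (auto simp: tabloid_of_def intro!: Collect_cong)
  have 2: "{restrict t (diagram lam) (i, j) |i. (i, j) \<in> diagram lam} = {t (i, j) |i. (i, j) \<in> diagram lam}" for j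
    by auto
  show ?thesis
    unfolding polytabloid_def column_stabilizer_def 1 2 ..
qed

lemma ex_is_basis_specht: "\<exists>B. is_basis (specht lam) B"
proof -
  have "{polytabloid lam t |t. is_tableau lam t} \<subseteq>
      polytabloid lam ` (diagram lam \<rightarrow>\<^sub>E {1..sum_list lam})"
  proof clarify
    fix t assume "is_tableau lam t"
    then have "restrict t (diagram lam) \<in> diagram lam \<rightarrow>\<^sub>E {1..sum_list lam}"
      by (auto simp: is_tableau_def bij_betw_def)
    then show "polytabloid lam t \<in> polytabloid lam ` (diagram lam \<rightarrow>\<^sub>E {1..sum_list lam})"
      using polytabloid_restrict by (metis imageI)
  qed
  moreover have "finite (polytabloid lam ` (diagram lam \<rightarrow>\<^sub>E {1..sum_list lam}))"
    by (intro finite_imageI finite_PiE finite_diagram) auto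
  ultimately show ?thesis
    unfolding specht_def by (intro ex_is_basis_span) (rule finite_subset)
qed

lemma irr_char_conjugate:
  assumes g: "g permutes {1..sum_list lam}" and h: "h permutes {1..sum_list lam}"
  shows "irr_char lam (g \<circ> h \<circ> inv g) = irr_char lam h"
proof -
  obtain B where B: "is_basis (specht lam) B" using ex_is_basis_specht by blast
  note bij = permutes_bij[OF g] permutes_bij[OF h] bij_imp_bij_inv[OF permutes_bij[OF g]]
  have "irr_char lam (g \<circ> h \<circ> inv g) =
      trace_on (specht lam) (\<lambda>v. perm_act g (perm_act (h \<circ> inv g) v))"
    unfolding irr_char_def
    by (rule arg_cong[where f = "trace_on _"]) (simp add: fun_eq_iff perm_act_compose bij bij_comp o_assoc [symmetric])
  \<comment> \<open>Cyclicity of the trace moves \<open>g\<close> to the right end, where it cancels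
    against \<open>inv g\<close>.\<close>
  also have "\<dots> = trace_on (specht lam) (\<lambda>v. perm_act (h \<circ> inv g) (perm_act g v))"
    using g h by (intro trace_on_commute[OF B] module_hom_perm_act perm_act_specht permutes_compose permutes_inv)
  also have "\<dots> = irr_char lam h"
    unfolding irr_char_def using inj_iff[of g] permutes_inj[OF g]
    by (intro arg_cong[where f = "trace_on _"] ext)
      (simp add: perm_act_compose[symmetric] bij bij_comp o_assoc [symmetric] del: o_apply)
  finally show ?thesis .
qed

section \<open>Extension of scalars to the polynomial ring\<close>

lemma pconst_0 [simp]: "pconst 0 = 0"
  by (simp add: pconst_def)

lemma pconst_add: "pconst (a + b) = pconst a + pconst b"
  by (simp add: pconst_def single_add)

lemma pconst_mult: "pconst (a * b) = pconst a * pconst b"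
  by (simp add: pconst_def mult_single)

lemma pconst_sum: "pconst (sum f A) = (\<Sum>a\<in>A. pconst (f a))"
  by (induction A rule: infinite_finite_induct) (simp_all add: pconst_add)

lemma lookup_pconst_mult: "Poly_Mapping.lookup (pconst c * p) m = c * Poly_Mapping.lookup p m"
  by (simp add: pconst_def lookup_mult lookup_single when_mult)

lemma pconst_eq_iff [simp]: "pconst a = pconst b \<longleftrightarrow> a = b"
  unfolding pconst_def by (metis lookup_single_eq)

text \<open>In the realisation of the tensor product by polynomial-valued functions, this is the map
  sending \<open>v\<close> to 1 tensor \<open>v\<close>.\<close>

definition pext :: "('t \<Rightarrow> complex) \<Rightarrow> 't \<Rightarrow> 'x cpoly" where
  "pext v = (\<lambda>t. pconst (v t))"

lemma pext_eq_iff [simp]: "pext v = pext w \<longleftrightarrow> v = w"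
  by (simp add: pext_def fun_eq_iff)

lemma sum_pext_image: "(\<Sum>x\<in>pext ` B. f x) = (\<Sum>b\<in>B. f (pext b))"
  by (simp add: sum.reindex inj_on_def)

lemma sum_fun_apply: "(\<Sum>a\<in>A. f a) x = (\<Sum>a\<in>A. f a x)"
  by (induction A rule: infinite_finite_induct) simp_all

lemma pext_sum_pscale: "pext (\<Sum>b\<in>B. pscale (c b) b) = (\<Sum>b\<in>B. pscale (pconst (c b)) (pext b))"
  by (simp add: fun_eq_iff pext_def pscale_def sum_fun_apply pconst_sum pconst_mult)

lemma pext_expand:
  assumes "is_basis V B" "v \<in> V"
  shows "pext v = (\<Sum>b\<in>B. pscale (pconst (fmod.representation B v b)) (pext b))"
  unfolding pext_sum_pscale[symmetric] using assms
  by (subst fmod.sum_representation_eq) (auto simp: is_basis_def)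

lemma extend_scalars_pext: "extend_scalars V = fmod.span (pext ` V)"
  by (simp add: extend_scalars_def pext_def image_def)

text \<open>Taking the coefficient of one monomial \<open>m\<close> throughout a polynomial relation
  among the extended vectors leaves a complex relation among the original ones, which is trivial.
  This being so for every \<open>m\<close>, all polynomial coefficients vanish.\<close>

lemma independent_pext:
  fixes B :: "('t \<Rightarrow> complex) set"
  assumes B: "finite B" "fmod.independent B"
  shows "fmod.independent (pext ` B :: ('t \<Rightarrow> 'x cpoly) set)"
proof -
  have "u (pext b) = 0"
    if u: "(\<Sum>x\<in>pext ` B. pscale (u x) x) = 0" and b: "b \<in> B"
    for u :: "('t \<Rightarrow> 'x cpoly) \<Rightarrow> 'x cpoly" and b
  proof (rule poly_mapping_eqI)
    fix m
    have *: "(\<Sum>b\<in>B. pscale (u (pext b)) (pext b)) = 0"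
      using u by (simp add: sum_pext_image)
    have "(\<Sum>b\<in>B. pscale (Poly_Mapping.lookup (u (pext b)) m) b) = 0"
    proof
      fix t
      have "Poly_Mapping.lookup ((\<Sum>b\<in>B. pscale (u (pext b)) (pext b)) t) m = 0"
        by (simp add: *)
      then show "(\<Sum>b\<in>B. pscale (Poly_Mapping.lookup (u (pext b)) m) b) t = 0 t"
        by (simp add: sum_fun_apply lookup_sum pscale_def pext_def lookup_pconst_mult mult.commute)
    qed
    with B b show "Poly_Mapping.lookup (u (pext b)) m = Poly_Mapping.lookup 0 m"
      using fmod.independentD[of B B "\<lambda>b. Poly_Mapping.lookup (u (pext b)) m" b] by simp
  qed
  with B show ?thesis
    by (subst fmod.dependent_finite) auto
qed

lemma is_basis_pext:
  assumes B: "is_basis V B"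
  shows "is_basis (extend_scalars V) (pext ` B)"
proof -
  have "pext v \<in> fmod.span (pext ` B)" if "v \<in> V" for v
    unfolding pext_expand[OF B that] by (intro fmod.span_sum fmod.span_scale fmod.span_base imageI)
  moreover have "B \<subseteq> V"
    using B by (auto simp: is_basis_def intro: fmod.span_base)
  ultimately have "fmod.span (pext ` B) = extend_scalars V"
    unfolding extend_scalars_pext
    by (intro antisym fmod.span_mono fmod.span_minimal fmod.subspace_span image_mono) auto
  with B show ?thesis
    by (simp add: is_basis_def independent_pext)
qed

text \<open>The complex expansion of \<open>v\<close> in \<open>B\<close> is carried over by
  \<open>pext\<close>, and coordinates in a basis are unique. Hence complex matrices reappear over
  the polynomial ring with constant entries.\<close>

lemma representation_pext:
  fixes B :: "('t \<Rightarrow> complex) set"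
  assumes B: "is_basis V B" and v: "v \<in> V" and b: "b \<in> B"
  shows "fmod.representation (pext ` B :: ('t \<Rightarrow> 'x cpoly) set) (pext v) (pext b) =
    pconst (fmod.representation B v b)"
proof -
  have ind: "fmod.independent (pext ` B :: ('t \<Rightarrow> 'x cpoly) set)"
    using B by (intro independent_pext) (auto simp: is_basis_def)
  have "fmod.representation (pext ` B :: ('t \<Rightarrow> 'x cpoly) set) (pext v) (pext b) =
      (\<Sum>c\<in>B. pconst (fmod.representation B v c) * fmod.representation (pext ` B) (pext c) (pext b))"
    unfolding pext_expand[OF B v] using ind
    by (subst fmod.representation_sum)
      (auto simp: fmod.span_base fmod.span_scale fmod.representation_scale)
  also have "\<dots> = (\<Sum>c\<in>B. if c = b then pconst (fmod.representation B v c) else 0)"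
    using ind by (intro sum.cong) (auto simp: fmod.representation_basis)
  finally show ?thesis
    using B b by (simp add: is_basis_def)
qed

lemma perm_act_pext: "perm_act g (pext v) = pext (perm_act g v)"
  by (simp add: perm_act_def pext_def)

lemma module_hom_ga_act: "module_hom pscale pscale (ga_act n a)"
proof (intro module_hom.intro fmod.module_axioms module_hom_axioms.intro)
  interpret p: module_hom pscale pscale "perm_act g" for g by (rule module_hom_perm_act)
  show "ga_act n a (v + w) = ga_act n a v + ga_act n a w" for v w
    by (simp add: ga_act_def p.add fmod.scale_right_distrib sum.distrib)
  show "ga_act n a (pscale c v) = pscale c (ga_act n a v)" for c v
    by (simp add: ga_act_def p.scale fmod.scale_sum_right mult.commute)
qed

lemma perm_act_extend_scalars:
  assumes g: "g permutes {1..sum_list lam}" and v: "v \<in> extend_scalars (specht lam)"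
  shows "perm_act g v \<in> extend_scalars (specht lam)"
proof -
  interpret g: module_hom pscale pscale "perm_act g :: (tabloid \<Rightarrow> 'x cpoly) \<Rightarrow> _"
    by (rule module_hom_perm_act)
  have "perm_act g ` pext ` specht lam \<subseteq> pext ` specht lam"
    using perm_act_specht[OF g] by (auto simp: perm_act_pext)
  from fmod.span_mono[OF this] v show ?thesis
    unfolding extend_scalars_pext g.span_image by blast
qed

text \<open>The trace is linear in the group algebra element, which reduces the claim to a single
  permutation. In the extended basis its matrix is the complex one with constant entries, so its
  trace is the constant given by the character value.\<close>

lemma trace_on_ga_act:
  "trace_on (extend_scalars (specht lam)) (ga_act (sum_list lam) a) =
    (\<Sum>g | g permutes {1..sum_list lam}. a g * pconst (irr_char lam g))"
proof -
  let ?P = "{g. g permutes {1..sum_list lam}}" and ?V = "specht lam"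
  let ?W = "extend_scalars ?V :: (tabloid \<Rightarrow> 'a cpoly) set"
  obtain B where B: "is_basis ?V B" using ex_is_basis_specht by blast
  define C :: "(tabloid \<Rightarrow> 'a cpoly) set" where "C = pext ` B"
  have C: "is_basis ?W C"
    unfolding C_def by (rule is_basis_pext[OF B])
  have BV: "b \<in> ?V" if "b \<in> B" for b
    using B that by (auto simp: is_basis_def intro: fmod.span_base)
  have CW: "c \<in> ?W" if "c \<in> C" for c
    using C that by (auto simp: is_basis_def intro: fmod.span_base)
  have spanC: "fmod.span C = ?W" and indC: "fmod.independent C"
    using C by (auto simp: is_basis_def)
  \<comment> \<open>Coordinates are additive only on the span of the basis, so each summand of the
    action has to be placed there first.\<close>
  have in_span: "perm_act g v \<in> fmod.span C" if "g \<in> ?P" "v \<in> ?W" for g v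
    using that perm_act_extend_scalars unfolding spanC by blast
  then have act: "ga_act (sum_list lam) a v \<in> ?W" if "v \<in> ?W" for v
    using that unfolding ga_act_def spanC[symmetric]
    by (intro fmod.span_sum fmod.span_scale) auto
  have "trace_on ?W (ga_act (sum_list lam) a) =
      (\<Sum>c\<in>C. fmod.representation C (ga_act (sum_list lam) a c) c)"
    by (rule trace_on_eq[OF C module_hom_ga_act act])
  also have "\<dots> = (\<Sum>c\<in>C. \<Sum>g\<in>?P. a g * fmod.representation C (perm_act g c) c)"
  proof (rule sum.cong[OF refl])
    fix c assume "c \<in> C"
    then show "fmod.representation C (ga_act (sum_list lam) a c) c =
        (\<Sum>g\<in>?P. a g * fmod.representation C (perm_act g c) c)"
      unfolding ga_act_def using in_span CW indC
      by (subst fmod.representation_sum) (auto simp: fmod.span_scale fmod.representation_scale)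
  qed
  also have "\<dots> = (\<Sum>g\<in>?P. a g * (\<Sum>c\<in>C. fmod.representation C (perm_act g c) c))"
    by (subst sum.swap) (simp add: sum_distrib_left)
  also have "\<dots> = (\<Sum>g\<in>?P. a g * pconst (irr_char lam g))"
  proof (rule sum.cong[OF refl])
    fix g assume "g \<in> ?P"
    then have g: "g permutes {1..sum_list lam}" by simp
    have "(\<Sum>c\<in>C. fmod.representation C (perm_act g c) c) =
        (\<Sum>b\<in>B. fmod.representation C (perm_act g (pext b)) (pext b))"
      by (simp add: C_def sum_pext_image)
    also have "\<dots> = (\<Sum>b\<in>B. pconst (fmod.representation B (perm_act g b) b))"
      unfolding perm_act_pext C_def
      using representation_pext[OF B] BV perm_act_specht[OF g] by (intro sum.cong) auto
    also have "\<dots> = pconst (irr_char lam g)"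
      unfolding irr_char_def using perm_act_specht[OF g]
      by (subst trace_on_eq[OF B module_hom_perm_act]) (auto simp: pconst_sum)
    finally show "a g * (\<Sum>c\<in>C. fmod.representation C (perm_act g c) c) =
        a g * pconst (irr_char lam g)" by simp
  qed
  finally show ?thesis .
qed

section \<open>Products of edge transpositions\<close>

text \<open>A transposition is symmetric in its two points, so both orderings of the edge describe
  the same permutation and the definite description is met.\<close>

lemma edge_transp_doubleton: "edge_transp {i, j} = Transposition.transpose i j"
  unfolding edge_transp_def
  by (rule the_equality) (auto simp: doubleton_eq_iff transpose_commute)

lemma edge_transp_permutes:
  assumes "e \<subseteq> A" "card e = 2"
  shows "edge_transp e permutes A"
  using assms by (auto simp: card_2_iff edge_transp_doubleton intro: permutes_swap_id)

lemma edge_transp_image: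
  assumes "bij g" "card e = 2"
  shows "edge_transp (g ` e) = g \<circ> edge_transp e \<circ> inv g"
proof -
  obtain i j where e: "e = {i, j}" using assms(2) by (auto simp: card_2_iff)
  have "Transposition.transpose (g i) (g j) \<circ> g = g \<circ> Transposition.transpose i j"
    using assms(1) by (simp add: transpose_comp_eq bij_is_inj)
  then have "Transposition.transpose (g i) (g j) \<circ> (g \<circ> inv g) = g \<circ> Transposition.transpose i j \<circ> inv g"
    by (simp add: o_assoc)
  with assms(1) show ?thesis
    by (simp add: e edge_transp_doubleton surj_iff[THEN iffD1] bij_is_surj)
qed

text \<open>The product of labelled transpositions in \<open>coeff_lab\<close>, isolated so that
  relabelling can be studied word by word; the last letter acts first.\<close>

definition word_perm :: "('v \<Rightarrow> nat) \<Rightarrow> 'v set list \<Rightarrow> nat \<Rightarrow> nat" where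
  "word_perm \<phi> w = foldr (\<lambda>e p. edge_transp (\<phi> ` e) \<circ> p) w id"

lemma word_perm_simps [simp]:
  "word_perm \<phi> [] = id"
  "word_perm \<phi> (e # w) = edge_transp (\<phi> ` e) \<circ> word_perm \<phi> w"
  by (simp_all add: word_perm_def)

lemma coeff_lab_word_perm:
  "coeff_lab n P \<phi> = (\<Sum>w\<in>mult_words P. irr_char [n - 2, 2] (word_perm \<phi> w))"
  by (simp add: coeff_lab_def word_perm_def)

lemma word_perm_map: "word_perm \<phi> (map (image f) w) = word_perm (\<phi> \<circ> f) w"
  by (induction w) (simp_all add: image_comp)

lemma word_perm_permutes:
  assumes "\<And>e. e \<in> set w \<Longrightarrow> \<phi> ` e \<subseteq> A \<and> card (\<phi> ` e) = 2"
  shows "word_perm \<phi> w permutes A"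
  using assms
  by (induction w) (auto simp: permutes_id intro!: permutes_compose edge_transp_permutes)

text \<open>Each relabelled transposition is a conjugate by \<open>g\<close>, and the inner factors
  \<open>inv g \<circ> g\<close> telescope.\<close>

lemma word_perm_compose:
  assumes g: "bij g" and "\<And>e. e \<in> set w \<Longrightarrow> card (\<phi> ` e) = 2"
  shows "word_perm (g \<circ> \<phi>) w = g \<circ> word_perm \<phi> w \<circ> inv g"
  using assms(2)
proof (induction w)
  case Nil
  then show ?case
    using surj_iff[THEN iffD1, OF bij_is_surj[OF g]] by simp
next
  case (Cons e w)
  have "inv g (g x) = x" for x
    using g by (simp add: bij_is_inj)
  moreover have "edge_transp (g ` \<phi> ` e) = g \<circ> edge_transp (\<phi> ` e) \<circ> inv g"
    using Cons.prems by (intro edge_transp_image g) simp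
  moreover have "(g \<circ> \<phi>) ` e = g ` \<phi> ` e" by auto
  ultimately show ?case
    using Cons by (simp add: fun_eq_iff del: o_apply) simp
qed

lemma word_perm_cong:
  assumes "\<And>e x. e \<in> set w \<Longrightarrow> x \<in> e \<Longrightarrow> \<phi> x = \<psi> x"
  shows "word_perm \<phi> w = word_perm \<psi> w"
  using assms
proof (induction w)
  case (Cons e w)
  then have "\<phi> ` e = \<psi> ` e" by (intro image_cong) auto
  moreover have "word_perm \<phi> w = word_perm \<psi> w" by (rule Cons.IH) (use Cons.prems in auto)
  ultimately show ?case by simp
qed simp

section \<open>Independence of the coefficient from the labelling\<close>

text \<open>Both images have as many elements as \<open>V\<close>, so their complements in the
  finite set \<open>A\<close> are equinumerous, and any bijection between the complements completes
  the partial map from \<open>\<phi> v\<close> to \<open>\<psi> v\<close>.\<close>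

lemma ex_permutes_extending:
  assumes A: "finite A" and f: "inj_on \<phi> V" "\<phi> ` V \<subseteq> A" and g: "inj_on \<psi> V" "\<psi> ` V \<subseteq> A"
  shows "\<exists>p. p permutes A \<and> (\<forall>v\<in>V. p (\<phi> v) = \<psi> v)"
proof -
  have fin: "finite (\<phi> ` V)" "finite (\<psi> ` V)"
    using A f g finite_subset by blast+
  have "card (A - \<phi> ` V) = card (A - \<psi> ` V)"
    using f g by (simp add: card_Diff_subset fin card_image)
  then obtain h where h: "bij_betw h (A - \<phi> ` V) (A - \<psi> ` V)"
    using A finite_same_card_bij by blast
  define k where "k = (\<lambda>x. \<psi> (inv_into V \<phi> x))"
  have k: "k (\<phi> v) = \<psi> v" if "v \<in> V" for v
    using f that by (simp add: k_def)
  have bk: "bij_betw k (\<phi> ` V) (\<psi> ` V)"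
    using f g k by (auto simp: bij_betw_def inj_on_def image_image)
  \<comment> \<open>The last branch fixes everything outside \<open>A\<close>, as
    \<open>permutes\<close> demands.\<close>
  define p where "p = (\<lambda>x. if x \<in> \<phi> ` V then k x else if x \<in> A then h x else x)"
  have "bij_betw p (\<phi> ` V) (\<psi> ` V)" "bij_betw p (A - \<phi> ` V) (A - \<psi> ` V)"
    by (rule bij_betw_cong[THEN iffD1, OF _ bk], simp add: p_def)
      (rule bij_betw_cong[THEN iffD1, OF _ h], simp add: p_def)
  then have "bij_betw p (\<phi> ` V \<union> (A - \<phi> ` V)) (\<psi> ` V \<union> (A - \<psi> ` V))"
    by (rule bij_betw_combine) auto
  then have "bij_betw p A A"
    using f g by (simp add: Un_absorb1)
  then have "p permutes A"
    using f by (intro bij_imp_permutes) (auto simp: p_def)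
  with k show ?thesis by (auto simp: p_def)
qed

lemma labelling_edge:
  assumes "is_forest F" "labelling n (F, \<alpha>) \<phi>" "e \<in> F"
  shows "\<phi> ` e \<subseteq> {1..n} \<and> card (\<phi> ` e) = 2"
proof -
  have "inj_on \<phi> e"
    using assms by (auto simp: labelling_def intro: inj_on_subset)
  with assms show ?thesis
    by (auto simp: labelling_def is_forest_def card_image)
qed

text \<open>A permutation of \<open>{1..n}\<close> carrying one labelling to the other conjugates
  the product of every word, so the two sums agree term by term.\<close>

lemma coeff_lab_labelling:
  assumes n: "2 \<le> n" and F: "is_forest (fst P)" and f: "labelling n P \<phi>" and g: "labelling n P \<psi>"
  shows "coeff_lab n P \<phi> = coeff_lab n P \<psi>"
proof -
  obtain F \<alpha> where P: "P = (F, \<alpha>)" by fastforce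
  \<comment> \<open>Subtraction on \<open>nat\<close> is truncated; \<open>2 \<le> n\<close> ensures
    that the parts add up to \<open>n\<close>.\<close>
  have sl: "sum_list [n - 2, 2] = n" using n by simp
  have "\<exists>p. p permutes {1..n} \<and> (\<forall>v\<in>\<Union>F. p (\<phi> v) = \<psi> v)"
    using f g by (intro ex_permutes_extending) (simp_all add: labelling_def P)
  then obtain p where p: "p permutes {1..n}" "\<forall>v\<in>\<Union>F. p (\<phi> v) = \<psi> v" by blast
  have "irr_char [n - 2, 2] (word_perm \<phi> w) = irr_char [n - 2, 2] (word_perm \<psi> w)"
    if "w \<in> mult_words P" for w
  proof -
    have w: "set w \<subseteq> F" using that by (auto simp: P mult_words_def)
    have e: "\<phi> ` e \<subseteq> {1..n} \<and> card (\<phi> ` e) = 2" if "e \<in> set w" for e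
      using labelling_edge[of F n \<alpha> \<phi> e] F f w that by (auto simp: P)
    have "word_perm \<psi> w = word_perm (p \<circ> \<phi>) w"
      using p(2) w by (intro word_perm_cong) (metis UnionI comp_apply subsetD)
    also have "\<dots> = p \<circ> word_perm \<phi> w \<circ> inv p"
      using p(1) e by (intro word_perm_compose permutes_bij) auto
    finally show ?thesis
      using irr_char_conjugate[of p "[n - 2, 2]" "word_perm \<phi> w"] p(1) word_perm_permutes[OF e]
      by (simp only: sl)
  qed
  then show ?thesis
    by (simp add: coeff_lab_word_perm)
qed

section \<open>Isomorphisms of forests with edge multiplicities\<close>

lemma wf_iso_iff:
  "wf_iso (F, \<alpha>) (G, \<beta>) \<longleftrightarrow>
    (\<exists>f. bij_betw f (\<Union>F) (\<Union>G) \<and> image f ` F = G \<and> (\<forall>e\<in>F. \<beta> (f ` e) = \<alpha> e))"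
  by (simp add: wf_iso_def)

lemma wf_iso_refl: "wf_iso P P"
  by (cases P) (auto simp: wf_iso_iff bij_betw_def intro!: exI[of _ "\<lambda>x. x"])

lemma wf_iso_sym:
  assumes "wf_iso P Q"
  shows "wf_iso Q P"
proof -
  obtain F \<alpha> G \<beta> where PQ: "P = (F, \<alpha>)" "Q = (G, \<beta>)" by fastforce
  with assms obtain f where f: "bij_betw f (\<Union>F) (\<Union>G)" "image f ` F = G" "\<And>e. e \<in> F \<Longrightarrow> \<beta> (f ` e) = \<alpha> e"
    by (auto simp: wf_iso_def)
  define g where "g = inv_into (\<Union>F) f"
  have g: "g ` f ` e = e" if "e \<in> F" for e
    unfolding g_def using f(1) that by (intro inv_into_image_cancel) (auto simp: bij_betw_def)
  have "bij_betw g (\<Union>G) (\<Union>F)"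
    unfolding g_def by (rule bij_betw_inv_into[OF f(1)])
  moreover have "image g ` G = F"
    using g unfolding f(2)[symmetric] by (force simp: image_image)
  moreover have "\<forall>e\<in>G. \<alpha> (g ` e) = \<beta> e"
    using g f(3) unfolding f(2)[symmetric] by auto
  ultimately show ?thesis
    by (auto simp: PQ wf_iso_def)
qed

lemma wf_iso_trans:
  assumes "wf_iso P Q" "wf_iso Q R"
  shows "wf_iso P R"
proof -
  obtain F \<alpha> G \<beta> H \<gamma> where PQ: "P = (F, \<alpha>)" "Q = (G, \<beta>)" "R = (H, \<gamma>)" by (metis surj_pair)
  obtain f g where
    f: "bij_betw f (\<Union>F) (\<Union>G)" "image f ` F = G" "\<forall>e\<in>F. \<beta> (f ` e) = \<alpha> e" and
    g: "bij_betw g (\<Union>G) (\<Union>H)" "image g ` G = H" "\<forall>e\<in>G. \<gamma> (g ` e) = \<beta> e"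
    using assms unfolding PQ wf_iso_iff by (elim exE conjE) blast
  have "image (g \<circ> f) ` F = H"
    unfolding g(2)[symmetric] f(2)[symmetric] by (simp add: image_image)
  moreover have "\<forall>e\<in>F. \<gamma> ((g \<circ> f) ` e) = \<alpha> e"
    using f(3) g(3) unfolding f(2)[symmetric] by (auto simp: image_comp)
  ultimately show ?thesis
    using bij_betw_trans[OF f(1) g(1)] by (auto simp: PQ wf_iso_def)
qed

text \<open>A bijection of vertices is injective on edges, so the sum can be reindexed. This
  supplies the total multiplicity of the members of \<open>copies\<close>, whose definition mentions
  no total.\<close>

lemma wf_iso_total:
  assumes "wf_iso (F, \<alpha>) (G, \<beta>)"
  shows "(\<Sum>e\<in>F. \<alpha> e) = (\<Sum>e\<in>G. \<beta> e)"
proof -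
  obtain f where f: "bij_betw f (\<Union>F) (\<Union>G)" "image f ` F = G" "\<And>e. e \<in> F \<Longrightarrow> \<beta> (f ` e) = \<alpha> e"
    using assms by (auto simp: wf_iso_def)
  have "inj_on (image f) F"
    using f(1) by (auto simp: bij_betw_def intro: inj_on_subset[OF inj_on_image_Pow])
  with f show ?thesis
    unfolding f(2)[symmetric] by (simp add: sum.reindex)
qed

text \<open>Applying \<open>f\<close> letter by letter is a bijection between the two sets of words,
  since it is injective on edges and preserves counts; the labelling is pulled back along
  \<open>f\<close>.\<close>

lemma coeff_lab_iso:
  assumes "bij_betw f (\<Union>F) (\<Union>G)" "image f ` F = G" "\<And>e. e \<in> F \<Longrightarrow> \<beta> (f ` e) = \<alpha> e"
  shows "coeff_lab n (G, \<beta>) \<phi> = coeff_lab n (F, \<alpha>) (\<phi> \<circ> f)"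
proof -
  have inj: "inj_on (image f) F"
    using assms(1) by (auto simp: bij_betw_def intro: inj_on_subset[OF inj_on_image_Pow])
  have cnt: "count_list (map (image f) w) (f ` e) = count_list w e" if "set w \<subseteq> F" "e \<in> F" for w e
    using that inj by (induction w) (auto dest: inj_onD)
  have "bij_betw (map (image f)) (mult_words (F, \<alpha>)) (mult_words (G, \<beta>))"
  proof (rule bij_betwI[where g = "map (inv_into F (image f))"])
    show "map (image f) \<in> mult_words (F, \<alpha>) \<rightarrow> mult_words (G, \<beta>)"
      using cnt assms(3) unfolding assms(2)[symmetric] by (auto simp: mult_words_def subset_iff)
    have inv: "inv_into F (image f) (f ` e) = e" if "e \<in> F" for e
      using inj that by simp
    have inv': "f ` inv_into F (image f) e = e" if "e \<in> G" for e
      using assms(2) that f_inv_into_f[of e "image f" F] by simp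
    have into: "inv_into F (image f) e \<in> F" if "e \<in> G" for e
      using assms(2) that inv_into_into[of e "image f" F] by simp
    show "map (inv_into F (image f)) (map (image f) w) = w" if "w \<in> mult_words (F, \<alpha>)" for w
      using that inv by (auto simp: mult_words_def intro!: map_idI)
    show right: "map (image f) (map (inv_into F (image f)) w) = w" if "w \<in> mult_words (G, \<beta>)" for w
      using that inv' by (auto simp: mult_words_def intro!: map_idI)
    show "map (inv_into F (image f)) \<in> mult_words (G, \<beta>) \<rightarrow> mult_words (F, \<alpha>)"
    proof
      fix w assume w: "w \<in> mult_words (G, \<beta>)"
      define u where "u = map (inv_into F (image f)) w"
      have u: "set u \<subseteq> F" "map (image f) u = w"
        using w into right[OF w] by (auto simp: u_def mult_words_def)
      have "count_list u e = \<alpha> e" if "e \<in> F" for e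
        using cnt[OF u(1) that] w assms(2,3) that by (auto simp: u(2) mult_words_def)
      with u(1) show "u \<in> mult_words (F, \<alpha>)" by (simp add: mult_words_def)
    qed
  qed
  from sum.reindex_bij_betw[OF this, of "\<lambda>w. irr_char [n - 2, 2] (word_perm \<phi> w)"] show ?thesis
    by (simp add: coeff_lab_word_perm word_perm_map)
qed

section \<open>Existence of labellings and finiteness of the set of classes\<close>

lemma ex_labelling:
  assumes "P \<in> wforests n r"
  shows "\<exists>\<phi>. labelling n P \<phi>"
proof -
  obtain F \<alpha> where P: "P = (F, \<alpha>)" by fastforce
  with assms have F: "is_forest F" "card (\<Union>F) \<le> n" by (auto simp: wforests_def)
  \<comment> \<open>Infinite sets have \<open>card\<close> 0, so the bound \<open>n\<close> on the
    vertex count says something only once the vertex set is known to be finite.\<close>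
  then have "finite e" if "e \<in> F" for e
    using that by (intro card_ge_0_finite) (auto simp: is_forest_def)
  with F have "finite (\<Union>F)" by (auto simp: is_forest_def)
  with F show ?thesis
    using card_le_inj[of "\<Union>F" "{1..n}"] by (auto simp: P labelling_def)
qed

lemma forest_coeff_eq:
  assumes "2 \<le> n" "P \<in> wforests n r" "labelling n P \<phi>"
  shows "forest_coeff n P = coeff_lab n P \<phi>"
  unfolding forest_coeff_def
proof (rule coeff_lab_labelling)
  show "labelling n P (SOME \<phi>. labelling n P \<phi>)"
    by (rule someI[of "labelling n P", OF assms(3)])
qed (use assms in \<open>auto simp: wforests_def\<close>)

lemma forest_coeff_iso:
  assumes n: "2 \<le> n" and P: "P \<in> wforests n r" and Q: "Q \<in> wforests n r" and "wf_iso P Q"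
  shows "forest_coeff n P = forest_coeff n Q"
proof -
  obtain F \<alpha> G \<beta> where PQ: "P = (F, \<alpha>)" "Q = (G, \<beta>)" by fastforce
  with assms obtain f where f: "bij_betw f (\<Union>F) (\<Union>G)" "image f ` F = G" "\<And>e. e \<in> F \<Longrightarrow> \<beta> (f ` e) = \<alpha> e"
    by (auto simp: wf_iso_def)
  obtain \<phi> where l: "labelling n Q \<phi>" using ex_labelling[OF Q] by blast
  \<comment> \<open>Any labelling may be used to evaluate a coefficient, so the one for
    \<open>P\<close> is chosen as the pullback of the one for \<open>Q\<close>.\<close>
  then have l': "labelling n P (\<phi> \<circ> f)"
    using f(1) unfolding labelling_def PQ prod.case bij_betw_def
    by (metis comp_inj_on image_comp)
  show ?thesis
    unfolding forest_coeff_eq[OF n P l'] forest_coeff_eq[OF n Q l]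
    using coeff_lab_iso[OF f(1,2), of \<beta> \<alpha> n \<phi>] f(3) by (simp add: PQ)
qed

lemma equiv_wf_iso:
  "equiv (wforests n r) {(P, Q). P \<in> wforests n r \<and> Q \<in> wforests n r \<and> wf_iso P Q}"
proof (intro equivI refl_onI symI transI)
  fix P Q R :: "'a wforest"
  assume "(P, Q) \<in> {(P, Q). P \<in> wforests n r \<and> Q \<in> wforests n r \<and> wf_iso P Q}"
    "(Q, R) \<in> {(P, Q). P \<in> wforests n r \<and> Q \<in> wforests n r \<and> wf_iso P Q}"
  then show "(P, R) \<in> {(P, Q). P \<in> wforests n r \<and> Q \<in> wforests n r \<and> wf_iso P Q}"
    using wf_iso_trans[of P Q R] by blast
qed (auto intro: wf_iso_refl wf_iso_sym)

text \<open>Every class is that of a pair with vertices in \<open>{1..n}\<close>, of which there are finitely many.\<close>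

lemma finite_wforest_classes: "finite (wforest_classes n r)"
proof -
  define D :: "nat wforest set" where "D = (SIGMA F : Pow (Pow {1..n}). F \<rightarrow>\<^sub>E {..r})"
  have "finite D"
    unfolding D_def by (auto intro!: finite_SigmaI finite_PiE intro: finite_subset)
  moreover have "wforest_classes n r \<subseteq> (\<lambda>Q. {P \<in> wforests n r. wf_iso Q P}) ` D"
  proof
    fix K assume "K \<in> wforest_classes n r"
    then obtain P :: "nat wforest" where P: "P \<in> wforests n r" and
        "K = {(P, Q). P \<in> wforests n r \<and> Q \<in> wforests n r \<and> wf_iso P Q} `` {P}"
      unfolding wforest_classes_def by (rule quotientE) (rule that)
    then have K: "K = {Q \<in> wforests n r. wf_iso P Q}" by blast
    obtain F \<alpha> where PF: "P = (F, \<alpha>)" by fastforce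
    have F: "finite F" "\<alpha> \<in> F \<rightarrow>\<^sub>E {0<..}" "(\<Sum>e\<in>F. \<alpha> e) = r"
      using P by (auto simp: wforests_def PF is_forest_def)
    obtain \<phi> where l: "inj_on \<phi> (\<Union>F)" "\<phi> ` \<Union>F \<subseteq> {1..n}"
      using ex_labelling[OF P] by (auto simp: labelling_def PF)
    \<comment> \<open>\<open>Q\<close> is \<open>P\<close> transported along its labelling.
      Restricting the multiplicities makes them extensional, and the total \<open>r\<close> bounds
      each of them, so \<open>Q\<close> lies in the finite set \<open>D\<close>.\<close>
    define Q where "Q = (image \<phi> ` F, restrict (\<lambda>e. \<alpha> (inv_into (\<Union>F) \<phi> ` e)) (image \<phi> ` F))"
    have inv: "inv_into (\<Union>F) \<phi> ` \<phi> ` e = e" if "e \<in> F" for e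
      using l that by (intro inv_into_image_cancel) auto
    have "bij_betw \<phi> (\<Union>F) (\<Union>(image \<phi> ` F))"
      using l by (auto simp: bij_betw_def)
    then have iso: "wf_iso P Q"
      using inv by (auto simp: PF Q_def wf_iso_def intro!: exI[of _ \<phi>])
    have "\<alpha> e \<le> r" if "e \<in> F" for e
      using F that member_le_sum[of e F \<alpha>] by auto
    then have "Q \<in> D"
      using l inv by (auto simp: Q_def D_def)
    moreover have "K = {P \<in> wforests n r. wf_iso Q P}"
      unfolding K using iso by (auto intro: wf_iso_trans wf_iso_sym)
    ultimately show "K \<in> (\<lambda>Q. {P \<in> wforests n r. wf_iso Q P}) ` D" by blast
  qed
  ultimately show ?thesis by (rule finite_surj)
qed

section \<open>The trace polynomial as a sum over words\<close>

lemma prod_list_map_count: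
  assumes "finite S" "set w \<subseteq> S"
  shows "prod_list (map f w) = (\<Prod>e\<in>S. (f e :: 'a :: comm_monoid_mult) ^ count_list w e)"
  using assms(2)
proof (induction w)
  case (Cons e w)
  have "(\<Prod>x\<in>S. f x ^ count_list (e # w) x) = (\<Prod>x\<in>S. (if x = e then f x else 1) * f x ^ count_list w x)"
    by (intro prod.cong) auto
  also have "\<dots> = f e * (\<Prod>x\<in>S. f x ^ count_list w x)"
    using Cons.prems assms(1) by (simp add: prod.distrib)
  finally show ?case using Cons by simp
qed simp

text \<open>Substituting \<open>g = h \<circ> k\<close> unfolds the convolution. Pairing with an
  arbitrary function \<open>\<Phi>\<close> on permutations expresses evaluation of a linear
  functional on the product.\<close>

lemma sum_ga_mult:
  "(\<Sum>g | g permutes {1..n}. ga_mult n a b g * \<Phi> g) =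
    (\<Sum>h | h permutes {1..n}. a h * (\<Sum>k | k permutes {1..n}. b k * \<Phi> (h \<circ> k)))"
proof -
  let ?P = "{g. g permutes {1..n}}"
  have "(\<Sum>g\<in>?P. ga_mult n a b g * \<Phi> g) = (\<Sum>h\<in>?P. \<Sum>g\<in>?P. a h * (b (inv h \<circ> g) * \<Phi> g))"
    by (subst sum.swap) (simp add: ga_mult_def sum_distrib_right mult.assoc)
  also have "\<dots> = (\<Sum>h\<in>?P. \<Sum>k\<in>?P. a h * (b k * \<Phi> (h \<circ> k)))"
  proof (rule sum.cong[OF refl])
    fix h assume h: "h \<in> ?P"
    then have ih: "inv h (h x) = x" "h (inv h x) = x" for x
      using permutes_inverses[of h] by auto
    show "(\<Sum>g\<in>?P. a h * (b (inv h \<circ> g) * \<Phi> g)) = (\<Sum>k\<in>?P. a h * (b k * \<Phi> (h \<circ> k)))"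
      using h by (intro sum.reindex_bij_witness[where i = "\<lambda>k. h \<circ> k" and j = "\<lambda>g. inv h \<circ> g"])
        (auto simp: fun_eq_iff ih o_def intro: permutes_compose[unfolded o_def] permutes_inv)
  qed
  finally show ?thesis by (simp add: sum_distrib_left)
qed

text \<open>Each factor of the power contributes a choice of edge, the leftmost factor being the
  first letter of the word. The induction needs arbitrary \<open>\<Phi>\<close>, because peeling off
  a factor \<open>h\<close> replaces \<open>\<Phi>\<close> by
  \<open>\<lambda>k. \<Phi> (h \<circ> k)\<close>.\<close>

lemma sum_ga_power_X_elem:
  assumes E: "finite E" "\<And>e. e \<in> E \<Longrightarrow> edge_transp e permutes {1..n}"
  shows "(\<Sum>g | g permutes {1..n}. ga_power n (X_elem E) r g * \<Phi> g) =
    (\<Sum>w | set w \<subseteq> E \<and> length w = r. prod_list (map pvar w) * \<Phi> (word_perm id w))"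
proof (induction r arbitrary: \<Phi>)
  case 0
  have "(\<Sum>g | g permutes {1..n}. ga_one g * \<Phi> g) =
      (\<Sum>g | g permutes {1..n}. if g = id then \<Phi> g else 0)"
    by (intro sum.cong) (auto simp: ga_one_def)
  also have "\<dots> = \<Phi> id"
    by (simp add: finite_permutations permutes_id)
  finally have *: "(\<Sum>g | g permutes {1..n}. ga_one g * \<Phi> g) = \<Phi> id" .
  have "{w. set w \<subseteq> E \<and> length w = 0} = {[]}" by auto
  with * show ?case by (simp add: id_def)
next
  case (Suc r)
  let ?P = "{g. g permutes {1..n}}" and ?W = "\<lambda>r. {w. set w \<subseteq> E \<and> length w = r}"
  let ?\<Psi> = "\<lambda>h. \<Sum>w\<in>?W r. prod_list (map pvar w) * \<Phi> (h \<circ> word_perm id w)"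
  have "(\<Sum>g\<in>?P. ga_power n (X_elem E) (Suc r) g * \<Phi> g) = (\<Sum>h\<in>?P. X_elem E h * ?\<Psi> h)"
    by (simp only: ga_power.simps sum_ga_mult Suc.IH[of "\<lambda>k. \<Phi> (_ \<circ> k)"])
  also have "\<dots> = (\<Sum>e\<in>E. \<Sum>h\<in>?P. if h = edge_transp e then pvar e * ?\<Psi> h else 0)"
    by (subst sum.swap) (auto simp: X_elem_def sum_distrib_right intro!: sum.cong)
  also have "\<dots> = (\<Sum>e\<in>E. pvar e * ?\<Psi> (edge_transp e))"
    using E by (intro sum.cong) (simp_all add: finite_permutations)
  also have "\<dots> = (\<Sum>(e, w)\<in>E \<times> ?W r. prod_list (map pvar (e # w)) * \<Phi> (word_perm id (e # w)))"
    by (simp add: sum.cartesian_product[symmetric] sum_distrib_left mult.assoc image_id)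
  also have "\<dots> = (\<Sum>w\<in>?W (Suc r). prod_list (map pvar w) * \<Phi> (word_perm id w))"
    by (rule sum.reindex_bij_witness[where i = "\<lambda>w. (hd w, tl w)" and j = "\<lambda>(e, w). e # w"])
      (auto simp: length_Suc_conv)
  finally show ?case .
qed

section \<open>Words grouped by edge multiplicities\<close>

text \<open>These pairs index the monomials of degree \<open>r\<close> in the edge variables:
  \<open>S\<close> is the support and \<open>\<beta>\<close> the exponents. Extensionality of
  \<open>\<beta>\<close> gives each monomial exactly one pair.\<close>

definition subforests :: "nat set set \<Rightarrow> nat \<Rightarrow> nat wforest set" where
  "subforests E r = {(S, \<beta>). S \<subseteq> E \<and> \<beta> \<in> S \<rightarrow>\<^sub>E {0<..} \<and> (\<Sum>e\<in>S. \<beta> e) = r}"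

lemma is_forest_subset:
  assumes "is_forest E" "S \<subseteq> E"
  shows "is_forest S"
proof -
  have "is_cycle E c" if "is_cycle S c" for c
    using that assms(2) by (auto simp: is_cycle_def)
  with assms show ?thesis
    by (auto simp: is_forest_def intro: finite_subset)
qed

lemma subforests_subset_wforests:
  assumes E: "is_forest E" "\<Union>E \<subseteq> {1..n}"
  shows "subforests E r \<subseteq> wforests n r"
proof clarify
  fix S \<beta> assume S: "(S, \<beta>) \<in> subforests E r"
  then have "\<Union>S \<subseteq> {1..n}" using E by (auto simp: subforests_def)
  from card_mono[OF _ this] S E show "(S, \<beta>) \<in> wforests n r"
    by (auto simp: subforests_def wforests_def intro: is_forest_subset)
qed

lemma finite_subforests:
  assumes "finite E"
  shows "finite (subforests E r)"
proof (rule finite_subset)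
  show "subforests E r \<subseteq> (SIGMA S : Pow E. S \<rightarrow>\<^sub>E {..r})"
  proof clarify
    fix S \<beta> assume S: "(S, \<beta>) \<in> subforests E r"
    then have "finite S" using assms by (auto simp: subforests_def intro: finite_subset)
    then have "\<beta> e \<le> r" if "e \<in> S" for e
      using S that member_le_sum[of e S \<beta>] by (auto simp: subforests_def)
    with S show "S \<in> Pow E \<and> \<beta> \<in> S \<rightarrow>\<^sub>E {..r}"
      by (auto simp: subforests_def PiE_iff)
  qed
  show "finite (SIGMA S : Pow E. S \<rightarrow>\<^sub>E {..r})"
    using assms by (auto intro!: finite_SigmaI finite_PiE intro: finite_subset)
qed

text \<open>Every word determines its support and the counts on it, and the fibres of this map are
  the sets \<open>mult_words P\<close>.\<close>

lemma sum_words_eq_sum_subforests: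
  assumes E: "finite E"
  shows "(\<Sum>w | set w \<subseteq> E \<and> length w = r. h w) =
    (\<Sum>P\<in>subforests E r. \<Sum>w\<in>mult_words P. h w)"
proof -
  let ?W = "{w. set w \<subseteq> E \<and> length w = r}"
  let ?k = "\<lambda>w. (set w, restrict (count_list w) (set w))"
  have "{w \<in> ?W. ?k w = P} = mult_words P" if "P \<in> subforests E r" for P
  proof -
    obtain S \<beta> where P: "P = (S, \<beta>)" by fastforce
    have S: "S \<subseteq> E" "\<beta> \<in> S \<rightarrow>\<^sub>E {0<..}" "(\<Sum>e\<in>S. \<beta> e) = r" "finite S"
      using that E by (auto simp: P subforests_def intro: finite_subset)
    show ?thesis
    proof (intro equalityI subsetI)
      fix w assume "w \<in> {w \<in> ?W. ?k w = P}"
      then show "w \<in> mult_words P" by (auto simp: P mult_words_def)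
    next
      fix w assume "w \<in> mult_words P"
      then have w: "set w \<subseteq> S" "\<And>e. e \<in> S \<Longrightarrow> count_list w e = \<beta> e"
        by (auto simp: P mult_words_def)
      \<comment> \<open>Positive multiplicities force every edge of \<open>S\<close> to occur, so
        the support of \<open>w\<close> is all of \<open>S\<close>.\<close>
      have "e \<in> set w" if "e \<in> S" for e
      proof (rule ccontr)
        assume "e \<notin> set w"
        then show False using w(2)[OF that] S(2) that by (auto simp: PiE_iff)
      qed
      with w(1) have set: "set w = S" by blast
      have "length w = r"
        using sum_count_set[OF w(1) S(4)] w(2) S(3) by simp
      moreover have "restrict (count_list w) S = \<beta>"
        using w(2) S(2) by (auto simp: fun_eq_iff PiE_iff extensional_def)
      ultimately show "w \<in> {w \<in> ?W. ?k w = P}"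
        using set S(1) by (simp add: P)
    qed
  qed
  moreover have "?k ` ?W \<subseteq> subforests E r"
    by (auto simp: subforests_def count_list_0_iff sum_count_set intro: gr0I)
  ultimately show ?thesis
    using sum.group[OF finite_lists_length_eq[OF E] finite_subforests[OF E], of ?k r r h] by simp
qed

lemma weighted_trace_poly_subforests:
  assumes n: "2 \<le> n" and E: "is_forest E" "\<Union>E \<subseteq> {1..n}"
  shows "weighted_trace_poly n r E =
    (\<Sum>P\<in>subforests E r. pconst (forest_coeff n P) * (\<Prod>e\<in>fst P. pvar e ^ snd P e))"
proof -
  have sl: "sum_list [n - 2, 2] = n" using n by simp
  have fE: "finite E" using E by (simp add: is_forest_def)
  let ?\<chi> = "\<lambda>w. irr_char [n - 2, 2] (word_perm id w)"
  have "weighted_trace_poly n r E =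
      (\<Sum>g | g permutes {1..n}. ga_power n (X_elem E) r g * pconst (irr_char [n - 2, 2] g))"
    unfolding weighted_trace_poly_def
    using trace_on_ga_act[of "[n - 2, 2]" "ga_power n (X_elem E) r"] unfolding sl .
  also have "\<dots> = (\<Sum>w | set w \<subseteq> E \<and> length w = r. prod_list (map pvar w) * pconst (?\<chi> w))"
    using E by (intro sum_ga_power_X_elem fE edge_transp_permutes) (auto simp: is_forest_def)
  also have "\<dots> = (\<Sum>P\<in>subforests E r. \<Sum>w\<in>mult_words P. prod_list (map pvar w) * pconst (?\<chi> w))"
    by (rule sum_words_eq_sum_subforests[OF fE])
  also have "\<dots> = (\<Sum>P\<in>subforests E r. pconst (forest_coeff n P) * (\<Prod>e\<in>fst P. pvar e ^ snd P e))"
  proof (rule sum.cong[OF refl])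
    fix P assume P: "P \<in> subforests E r"
    obtain S \<beta> where S: "P = (S, \<beta>)" by fastforce
    have fS: "finite S" using P fE by (auto simp: S subforests_def intro: finite_subset)
    \<comment> \<open>The vertices already lie in \<open>{1..n}\<close>, so the permutations arising
      from the expansion are those of the identity labelling.\<close>
    have lab: "labelling n P id"
      using P E(2) by (auto simp: S subforests_def labelling_def)
    have "prod_list (map pvar w) = (\<Prod>e\<in>S. pvar e ^ \<beta> e)" if "w \<in> mult_words P" for w
      using that by (subst prod_list_map_count[OF fS]) (auto simp: S mult_words_def intro!: prod.cong)
    then have "(\<Sum>w\<in>mult_words P. prod_list (map pvar w) * pconst (?\<chi> w)) =
        (\<Prod>e\<in>S. pvar e ^ \<beta> e) * pconst (coeff_lab n P id)"
      by (simp add: coeff_lab_word_perm pconst_sum sum_distrib_left)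
    also have "coeff_lab n P id = forest_coeff n P"
      using forest_coeff_eq[OF n _ lab, of r] P subforests_subset_wforests[OF E, of r] by auto
    finally show "(\<Sum>w\<in>mult_words P. prod_list (map pvar w) * pconst (?\<chi> w)) =
        pconst (forest_coeff n P) * (\<Prod>e\<in>fst P. pvar e ^ snd P e)"
      by (simp only: S fst_conv snd_conv mult.commute)
  qed
  finally show ?thesis .
qed

section \<open>Monomials collected by isomorphism class\<close>

lemma weighted_trace_poly_forests:
  assumes n: "2 \<le> n" and r: "1 \<le> r" and E: "is_forest E" "\<Union>E \<subseteq> {1..n}"
  shows "weighted_trace_poly n r E =
    (\<Sum>K\<in>wforest_classes n r. pconst (forest_coeff n (class_rep K)) *
       (\<Sum>(S, \<beta>)\<in>copies E (class_rep K). \<Prod>e\<in>S. pvar e ^ \<beta> e))"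
proof -
  let ?R = "{(P, Q). P \<in> wforests n r \<and> Q \<in> wforests n r \<and> wf_iso P Q} :: nat wforest rel"
  let ?mon = "\<lambda>P. \<Prod>e\<in>fst P. pvar e ^ snd P e"
  have fE: "finite E" using E by (simp add: is_forest_def)
  note sub = subforests_subset_wforests[OF E, of r]
  note eq = equiv_wf_iso[of n r]
  have rep: "class_rep K \<in> K" "K \<subseteq> wforests n r" "K = ?R `` {class_rep K}"
    if "K \<in> wforest_classes n r" for K
  proof -
    have K: "K \<in> wforests n r // ?R" using that by (simp add: wforest_classes_def)
    have "\<exists>P. P \<in> K" using in_quotient_imp_non_empty[OF eq K] unfolding ex_in_conv .
    then show 1: "class_rep K \<in> K"
      unfolding class_rep_def by (rule someI_ex)
    show "K \<subseteq> wforests n r" using in_quotient_imp_subset[OF eq K] .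
    show "K = ?R `` {class_rep K}"
    proof (rule quotientE[OF K])
      fix P assume P: "K = ?R `` {P}"
      with 1 have "(P, class_rep K) \<in> ?R" by (simp only: Image_singleton_iff)
      from equiv_class_eq[OF eq this] P show "K = ?R `` {class_rep K}" by (simp only:)
    qed
  qed
  \<comment> \<open>The embedded copies of the representative are the pairs in \<open>E\<close>
    lying in its class. Isomorphism forces the total \<open>r\<close> for a copy; conversely
    \<open>1 \<le> r\<close> makes the support of such a pair nonempty.\<close>
  have copies: "copies E (class_rep K) = {P \<in> subforests E r. ?R `` {P} = K}"
    if K: "K \<in> wforest_classes n r" for K
  proof -
    obtain F \<alpha> where F: "class_rep K = (F, \<alpha>)" by fastforce
    have FK: "(F, \<alpha>) \<in> wforests n r" using rep[OF K] F by auto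
    then have tot: "(\<Sum>e\<in>F. \<alpha> e) = r" by (simp add: wforests_def)
    have KF: "K = ?R `` {(F, \<alpha>)}"
      using rep(3)[OF K] unfolding F .
    have iff: "?R `` {P} = K \<longleftrightarrow> wf_iso P (F, \<alpha>)" if "P \<in> wforests n r" for P
      unfolding KF using eq_equiv_class_iff[OF eq that FK] that FK by simp
    have "P \<in> copies E (F, \<alpha>) \<longleftrightarrow> P \<in> subforests E r \<and> wf_iso P (F, \<alpha>)" for P
      using wf_iso_total[of "fst P" "snd P" F \<alpha>] tot r
      by (cases P) (auto simp: copies_def subforests_def)
    with iff sub show ?thesis unfolding F by blast
  qed
  have img: "(\<lambda>P. ?R `` {P}) ` subforests E r \<subseteq> wforest_classes n r"
  proof (rule image_subsetI)
    fix P assume "P \<in> subforests E r"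
    then have "P \<in> wforests n r" using sub by (rule rev_subsetD)
    then show "?R `` {P} \<in> wforest_classes n r"
      unfolding wforest_classes_def by (rule quotientI)
  qed
  have "weighted_trace_poly n r E = (\<Sum>P\<in>subforests E r. pconst (forest_coeff n P) * ?mon P)"
    by (rule weighted_trace_poly_subforests[OF n E])
  \<comment> \<open>Grouping along the class map requires both index sets to be finite, since a sum
    over an infinite set defaults to 0.\<close>
  also have "\<dots> = (\<Sum>K\<in>wforest_classes n r.
      \<Sum>P\<in>{P \<in> subforests E r. ?R `` {P} = K}. pconst (forest_coeff n P) * ?mon P)"
    by (intro sum.group[symmetric] finite_subforests fE finite_wforest_classes img)
  also have "\<dots> = (\<Sum>K\<in>wforest_classes n r. pconst (forest_coeff n (class_rep K)) *
       (\<Sum>(S, \<beta>)\<in>copies E (class_rep K). \<Prod>e\<in>S. pvar e ^ \<beta> e))"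
  proof (rule sum.cong[OF refl])
    fix K assume K: "K \<in> wforest_classes n r"
    \<comment> \<open>Invariance under isomorphism makes the coefficient constant on each class, so
      it factors out of the inner sum.\<close>
    have "forest_coeff n P = forest_coeff n (class_rep K)"
      if "P \<in> subforests E r" "?R `` {P} = K" for P
    proof -
      have "class_rep K \<in> ?R `` {P}" using rep(1)[OF K] unfolding that(2) .
      then show ?thesis using forest_coeff_iso[OF n, of P r "class_rep K"] by simp
    qed
    then show "(\<Sum>P\<in>{P \<in> subforests E r. ?R `` {P} = K}. pconst (forest_coeff n P) * ?mon P) =
        pconst (forest_coeff n (class_rep K)) *
          (\<Sum>(S, \<beta>)\<in>copies E (class_rep K). \<Prod>e\<in>S. pvar e ^ \<beta> e)"
      unfolding copies[OF K] by (simp add: sum_distrib_left case_prod_unfold)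
  qed
  finally show ?thesis .
qed

theorem mainTheorem7:
  fixes n r :: nat
  assumes "4 \<le> n" and "1 \<le> r"
  shows "(\<forall>(P :: 'a wforest) \<phi> \<psi>. P \<in> wforests n r \<longrightarrow> labelling n P \<phi> \<longrightarrow> labelling n P \<psi> \<longrightarrow>
            coeff_lab n P \<phi> = coeff_lab n P \<psi>) \<and>
         (\<forall>(P :: 'a wforest) (Q :: 'b wforest). P \<in> wforests n r \<longrightarrow> Q \<in> wforests n r \<longrightarrow> wf_iso P Q \<longrightarrow>
            forest_coeff n P = forest_coeff n Q) \<and>
         (\<forall>E. is_tree_on {1..n} E \<longrightarrow>
            weighted_trace_poly n r E =
              (\<Sum>K\<in>wforest_classes n r. pconst (forest_coeff n (class_rep K)) *
                 (\<Sum>(S, \<beta>)\<in>copies E (class_rep K). \<Prod>e\<in>S. pvar e ^ \<beta> e)))"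
proof (intro conjI allI impI)
  fix P :: "'a wforest" and \<phi> \<psi>
  assume "P \<in> wforests n r" "labelling n P \<phi>" "labelling n P \<psi>"
  then show "coeff_lab n P \<phi> = coeff_lab n P \<psi>"
    using assms(1) by (intro coeff_lab_labelling) (auto simp: wforests_def)
next
  fix P :: "'a wforest" and Q :: "'b wforest"
  assume "P \<in> wforests n r" "Q \<in> wforests n r" "wf_iso P Q"
  then show "forest_coeff n P = forest_coeff n Q"
    using assms(1) by (intro forest_coeff_iso) auto
next
  fix E assume "is_tree_on {1..n} E"
  then have E: "is_forest E" "\<Union>E \<subseteq> {1..n}" by (auto simp: is_tree_on_def)
  then show "weighted_trace_poly n r E =
      (\<Sum>K\<in>wforest_classes n r. pconst (forest_coeff n (class_rep K)) *
         (\<Sum>(S, \<beta>)\<in>copies E (class_rep K). \<Prod>e\<in>S. pvar e ^ \<beta> e))"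
    using assms by (intro weighted_trace_poly_forests) simp_all
qed

end
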